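(* Let $m\geq 2$ and $n=\binom{m}{2}$. Then the generic completion rank of the complete bipartite graph $K_{m,n}$ (color classes of sizes $m$ and $n$) equals $m$.
   Context: For a simple graph $H=(V,E)$ on $N$ vertices, $\pi_H:\mathrm{Sym}_N\to\mathbb{R}^N\oplus\mathbb{R}^E$ is $(a_{ij})\mapsto((a_{ii})_{i},(a_{ij})_{\{i,j\}\in E})$, and $V_r$ is the variety of symmetric $N\times N$ matrices of rank at most $r$. The generic completion rank $\mathrm{gcr}(H)$ is the smallest $r$ such that $\pi_H|_{V_r}$ is dominant, i.e. $\dim\pi_H(V_r)=N+|E|$. *)

theory Defs
  imports "HOL-Analysis.Analysis"
begin

text \<open>A graph on the vertex type \<open>'v\<close> (so N is \<open>CARD('v)\<close>) is given by its set of edges,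
  each edge being an unordered pair of distinct vertices.\<close>

definition simple_graph :: "'v set set \<Rightarrow> bool" where
  "simple_graph E \<longleftrightarrow> (\<forall>e\<in>E. card e = 2)"

definition complete_bipartite :: "'v set \<Rightarrow> 'v set \<Rightarrow> 'v set set" where
  "complete_bipartite A B = {{a, b} | a b. a \<in> A \<and> b \<in> B}"

lemma simple_graph_complete_bipartite:
  "A \<inter> B = {} \<Longrightarrow> simple_graph (complete_bipartite A B)"
  by (auto simp: simple_graph_def complete_bipartite_def card_insert_if)

definition sym_rank_variety :: "nat \<Rightarrow> (real^'v^'v) set" where
  "sym_rank_variety r = {M. transpose M = M \<and> rank M \<le> r}"

text \<open>Unambiguous only for symmetric matrices, see \<open>edge_entry_eq\<close>.\<close>

definition edge_entry :: "real^'v^'v \<Rightarrow> 'v set \<Rightarrow> real" where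
  "edge_entry M e = (THE c. \<exists>i j. e = {i, j} \<and> i \<noteq> j \<and> c = M $ i $ j)"

lemma edge_entry_eq:
  assumes "transpose M = M" "i \<noteq> j"
  shows "edge_entry M {i, j} = M $ i $ j"
proof -
  have "M $ j $ i = M $ i $ j"
    using assms(1) by (metis transpose_def vec_lambda_beta)
  then show ?thesis
    unfolding edge_entry_def using assms(2)
    by (intro the_equality) (auto simp: doubleton_eq_iff)
qed

text \<open>Since the edge set is a value and not a type, the space $R^N \oplus R^E$ is realised as the
  coordinate subspace of $R^N \oplus R^{P(V)}$ on which all coordinates outside \<open>E\<close> vanish.\<close>

definition partial_matrix_space :: "'v::finite set set \<Rightarrow> ((real^'v) \<times> (real^('v set))) set" where
  "partial_matrix_space E = {(d, w). \<forall>e. e \<notin> E \<longrightarrow> w $ e = 0}"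

definition graph_proj :: "'v::finite set set \<Rightarrow> real^'v^'v \<Rightarrow> (real^'v) \<times> (real^('v set))" where
  "graph_proj E M = ((\<chi> i. M $ i $ i), (\<chi> e. if e \<in> E then edge_entry M e else 0))"

text \<open>For a linear subspace \<open>T\<close> (an affine space) and \<open>S \<subseteq> T\<close>. Over the reals a polynomial is
  determined by its polynomial function.\<close>

definition zariski_dense_in :: "'b::real_normed_vector set \<Rightarrow> 'b set \<Rightarrow> bool" where
  "zariski_dense_in S T \<longleftrightarrow> S \<subseteq> T \<and>
     (\<forall>p. real_polynomial_function p \<and> (\<forall>x\<in>S. p x = 0) \<longrightarrow> (\<forall>x\<in>T. p x = 0))"

definition proj_dominant :: "'v::finite set set \<Rightarrow> nat \<Rightarrow> bool" where
  "proj_dominant E r \<longleftrightarrow>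
     zariski_dense_in (graph_proj E ` sym_rank_variety r) (partial_matrix_space E)"

definition gcr :: "'v::finite set set \<Rightarrow> nat" where
  "gcr E = (LEAST r. proj_dominant E r)"


subsection \<open>Dominance in terms of dimension\<close>

definition coord_proj :: "'b::euclidean_space set \<Rightarrow> 'b \<Rightarrow> 'b" where
  "coord_proj J x = (\<Sum>b\<in>J. (x \<bullet> b) *\<^sub>R b)"

text \<open>The coordinates in \<open>J\<close> are algebraically independent as functions on \<open>S\<close>.\<close>

definition coords_independent_on :: "'b::euclidean_space set \<Rightarrow> 'b set \<Rightarrow> bool" where
  "coords_independent_on S J \<longleftrightarrow> J \<subseteq> Basis \<and>
     (\<forall>p. real_polynomial_function p \<and> (\<forall>x\<in>S. p (coord_proj J x) = 0) \<longrightarrow>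
          (\<forall>x. p (coord_proj J x) = 0))"

text \<open>The dimension of the Zariski closure of a nonempty set \<open>S\<close>, as the maximal number of
  coordinates that are algebraically independent modulo the vanishing ideal of \<open>S\<close>.\<close>

definition zariski_dim :: "'b::euclidean_space set \<Rightarrow> nat" where
  "zariski_dim S = Max (card ` {J. coords_independent_on S J})"

definition pm_basis :: "'v::finite set set \<Rightarrow> ((real^'v) \<times> (real^('v set))) set" where
  "pm_basis E = (\<lambda>i. (axis i 1, 0)) ` UNIV \<union> (\<lambda>e. (0, axis e 1)) ` E"

lemma pm_basis_subset: "pm_basis E \<subseteq> Basis"
  by (auto simp: pm_basis_def Basis_prod_def Basis_vec_def)

lemma card_pm_basis: "card (pm_basis E) = CARD('v) + card (E :: 'v::finite set set)"
proof -
  have "card (pm_basis E) =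
      card ((\<lambda>i. (axis i 1, 0)) ` (UNIV::'v set) :: ((real^'v) \<times> (real^('v set))) set)
      + card ((\<lambda>e. (0, axis e 1)) ` E :: ((real^'v) \<times> (real^('v set))) set)"
    unfolding pm_basis_def by (intro card_Un_disjoint) (auto simp: axis_eq_0_iff)
  then show ?thesis
    by (simp add: card_image inj_on_def axis_eq_axis)
qed

lemma coord_proj_pm_basis:
  "coord_proj (pm_basis E) x = (fst x, \<chi> e. if e \<in> E then snd x $ e else 0)"
proof -
  have "coord_proj (pm_basis E) x =
      (\<Sum>b\<in>(\<lambda>i. (axis i 1, 0)) ` UNIV. (x \<bullet> b) *\<^sub>R b) +
      (\<Sum>b\<in>(\<lambda>e. (0, axis e 1)) ` E. (x \<bullet> b) *\<^sub>R b)"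
    unfolding pm_basis_def coord_proj_def
    by (intro sum.union_disjoint) (auto simp: axis_eq_0_iff)
  also have "\<dots> = (\<Sum>i\<in>UNIV. (x \<bullet> (axis i 1, 0)) *\<^sub>R (axis i 1, 0)) +
      (\<Sum>e\<in>E. (x \<bullet> (0, axis e 1)) *\<^sub>R (0, axis e 1))"
    by (subst (1 2) sum.reindex) (auto simp: inj_on_def axis_eq_axis)
  also have "\<dots> = (fst x, \<chi> e. if e \<in> E then snd x $ e else 0)"
  proof (rule prod_eqI, goal_cases)
    case 1
    show ?case
      by (simp add: fst_sum vec_eq_iff inner_prod_def inner_axis)
        (simp add: axis_def mult_delta_right)
  next
    case 2
    show ?case
      by (simp add: snd_sum vec_eq_iff inner_prod_def inner_axis)
        (simp add: axis_def mult_delta_right)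
  qed
  finally show ?thesis .
qed

lemma graph_proj_in: "graph_proj E M \<in> partial_matrix_space E"
  by (simp add: graph_proj_def partial_matrix_space_def)

lemma range_coord_proj_pm_basis: "range (coord_proj (pm_basis E)) = partial_matrix_space E"
proof
  show "range (coord_proj (pm_basis E)) \<subseteq> partial_matrix_space E"
    by (auto simp: coord_proj_pm_basis partial_matrix_space_def)
next
  show "partial_matrix_space E \<subseteq> range (coord_proj (pm_basis E))"
  proof
    fix x assume "x \<in> partial_matrix_space E"
    then have "x = coord_proj (pm_basis E) x"
      by (auto simp: coord_proj_pm_basis partial_matrix_space_def vec_eq_iff)
    then show "x \<in> range (coord_proj (pm_basis E))" by blast
  qed
qed

lemma coord_proj_id: "x \<in> partial_matrix_space E \<Longrightarrow> coord_proj (pm_basis E) x = x"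
  by (auto simp: coord_proj_pm_basis partial_matrix_space_def vec_eq_iff)

lemma dense_iff_independent:
  assumes "S \<subseteq> partial_matrix_space E"
  shows "zariski_dense_in S (partial_matrix_space E) \<longleftrightarrow> coords_independent_on S (pm_basis E)"
proof -
  have "(\<forall>x\<in>S. p (coord_proj (pm_basis E) x) = 0) \<longleftrightarrow> (\<forall>x\<in>S. p x = 0)" for p :: "_ \<Rightarrow> real"
    using assms by (auto simp: coord_proj_id subset_iff)
  moreover have "(\<forall>x. p (coord_proj (pm_basis E) x) = 0) \<longleftrightarrow> (\<forall>x\<in>partial_matrix_space E. p x = 0)"
    for p :: "_ \<Rightarrow> real"
    by (auto simp flip: range_coord_proj_pm_basis)
  ultimately show ?thesis
    using assms pm_basis_subset [of E]
    by (simp add: zariski_dense_in_def coords_independent_on_def)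
qed

lemma coord_proj_inner:
  assumes "J \<subseteq> Basis" "b \<in> J"
  shows "coord_proj J x \<bullet> b = x \<bullet> b"
proof -
  have "finite J" using assms(1) finite_Basis finite_subset by blast
  have "coord_proj J x \<bullet> b = (\<Sum>c\<in>J. (x \<bullet> c) * (c \<bullet> b))"
    by (simp add: coord_proj_def inner_sum_left)
  also have "\<dots> = (\<Sum>c\<in>J. if c = b then x \<bullet> c else 0)"
    using assms by (intro sum.cong) (auto simp: inner_Basis subset_iff)
  finally show ?thesis using \<open>finite J\<close> assms(2) by simp
qed

lemma independent_subset_pm_basis:
  assumes S: "S \<subseteq> partial_matrix_space E" and J: "coords_independent_on S J"
  shows "J \<subseteq> pm_basis E"
proof
  fix b assume b: "b \<in> J"
  have JB: "J \<subseteq> Basis" using J by (simp add: coords_independent_on_def)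
  have p: "real_polynomial_function (\<lambda>x. x \<bullet> b)"
    by (rule real_polynomial_function.intros(1) [OF bounded_linear_inner_left])
  show "b \<in> pm_basis E"
  proof (rule ccontr)
    assume nb: "b \<notin> pm_basis E"
    from b JB have "b \<in> Basis" by blast
    with nb obtain e where e: "b = (0, axis e 1)" "e \<notin> E"
      by (auto simp: pm_basis_def Basis_prod_def Basis_vec_def)
    have "\<forall>x\<in>S. x \<bullet> b = 0"
      using S e by (auto simp: partial_matrix_space_def inner_axis)
    then have "\<forall>x\<in>S. coord_proj J x \<bullet> b = 0"
      by (simp add: coord_proj_inner [OF JB b])
    then have "\<forall>x. coord_proj J x \<bullet> b = 0"
      using J p unfolding coords_independent_on_def by blast
    then have "b \<bullet> b = 0"
      using coord_proj_inner [OF JB b] by metis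
    then show False using \<open>b \<in> Basis\<close> by simp
  qed
qed

theorem proj_dominant_iff_dim:
  fixes E :: "'v::finite set set"
  shows "proj_dominant E r \<longleftrightarrow>
    zariski_dim (graph_proj E ` sym_rank_variety r) = CARD('v) + card E"
proof -
  let ?S = "graph_proj E ` sym_rank_variety r"
  let ?I = "{J. coords_independent_on ?S J}"
  have S: "?S \<subseteq> partial_matrix_space E" using graph_proj_in by blast
  have "(0::real^'v^'v) \<in> sym_rank_variety r"
    by (auto simp: sym_rank_variety_def transpose_def vec_eq_iff)
  then have "?S \<noteq> {}" by blast
  then have "coords_independent_on ?S {}"
    by (auto simp: coords_independent_on_def coord_proj_def)
  then have ne: "?I \<noteq> {}" by blast
  have sub: "J \<subseteq> pm_basis E" if "J \<in> ?I" for J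
    using independent_subset_pm_basis [OF S] that by blast
  have finb: "finite (pm_basis E)" by (simp add: pm_basis_def)
  then have fin: "finite ?I"
    using sub by (intro finite_subset [of ?I "Pow (pm_basis E)"]) auto
  have "proj_dominant E r \<longleftrightarrow> pm_basis E \<in> ?I"
    using dense_iff_independent [OF S] by (simp add: proj_dominant_def)
  also have "\<dots> \<longleftrightarrow> Max (card ` ?I) = card (pm_basis E)"
  proof
    assume "pm_basis E \<in> ?I"
    then show "Max (card ` ?I) = card (pm_basis E)"
      using fin finb sub by (intro Max_eqI) (auto intro: card_mono)
  next
    assume eq: "Max (card ` ?I) = card (pm_basis E)"
    have "Max (card ` ?I) \<in> card ` ?I" using fin ne by (intro Max_in) auto
    then obtain J where "J \<in> ?I" "card J = card (pm_basis E)" using eq by auto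
    then show "pm_basis E \<in> ?I" using sub finb card_subset_eq by metis
  qed
  finally show ?thesis by (simp add: zariski_dim_def card_pm_basis)
qed

text \<open>The minimum in \<open>gcr\<close> exists: every partial matrix has a completion.\<close>

lemma proj_dominant_card:
  fixes E :: "'v::finite set set"
  assumes "simple_graph E"
  shows "proj_dominant E CARD('v)"
proof -
  have "partial_matrix_space E \<subseteq> graph_proj E ` sym_rank_variety CARD('v)"
  proof
    fix x assume x: "x \<in> partial_matrix_space E"
    obtain d w where dw: "x = (d, w)" by (cases x)
    define M :: "real^'v^'v" where "M = (\<chi> i j. if i = j then d $ i else w $ {i, j})"
    have sym: "transpose M = M"
      by (auto simp: M_def transpose_def vec_eq_iff insert_commute)
    moreover have "rank M \<le> CARD('v)" using rank_bound [of M] by simp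
    ultimately have M: "M \<in> sym_rank_variety CARD('v)" by (simp add: sym_rank_variety_def)
    have "edge_entry M e = w $ e" if "e \<in> E" for e
    proof -
      have "card e = 2" using assms that by (simp add: simple_graph_def)
      then obtain i j where ij: "e = {i, j}" "i \<noteq> j" by (metis card_2_iff)
      then show ?thesis using edge_entry_eq [OF sym] by (simp add: M_def)
    qed
    then have "graph_proj E M = x"
      using x by (auto simp: graph_proj_def dw vec_eq_iff partial_matrix_space_def M_def)
    then show "x \<in> graph_proj E ` sym_rank_variety CARD('v)" using M by blast
  qed
  then show ?thesis
    using graph_proj_in by (auto simp: proj_dominant_def zariski_dense_in_def)
qed

end

theory Submission
  imports Defs
begin

text \<open>For $r < m$ some $m \times m$ minor involves known entries only: rows \<open>A\<close> against $m$ columns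
  from \<open>B\<close> if $m \ge 3$, and the principal minor on an edge if $m = 2$. It vanishes on the image of
  $V_r$ but not identically.

  For $r = m$, the symmetric matrices $(I \mid Y)^T P (I \mid Y)$ with $P$ of size $m \times m$ have rank
  at most $m$, and their known entries are the diagonal of $P$, the matrix $P Y$ and the numbers
  $y_b^T P y_b$. As $n = \binom{m}{2}$, there are as many parameters as known entries. At $P = I$ with
  the columns of $Y$ running through all $e_k + e_l$, the Jacobian is invertible, so the image
  contains an open set and is Zariski dense.\<close>

section \<open>Polynomials vanishing on large sets\<close>

text \<open>Along the line from \<open>z\<close> to \<open>x\<close> the polynomial becomes
  univariate. It vanishes for all small parameters, so it has infinitely many roots and is zero, in
  particular at parameter 1.\<close>

lemma real_polynomial_function_vanishing_on_interior:
  fixes p :: "'a::real_normed_vector \<Rightarrow> real"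
  assumes p: "real_polynomial_function p" and S: "\<And>x. x \<in> S \<Longrightarrow> p x = 0"
    and z: "z \<in> interior S"
  shows "p x = 0"
proof -
  define l where "l = (\<lambda>t::real. z + t *\<^sub>R (x - z))"
  have "polynomial_function l"
    unfolding l_def
    by (intro polynomial_function_add polynomial_function_const polynomial_function_bounded_linear
        bounded_linear_scaleR_left)
  then have "real_polynomial_function (p \<circ> l)"
    using p by (rule real_polynomial_function_compose)
  then obtain a n where a: "p \<circ> l = (\<lambda>t. \<Sum>i\<le>n. a i * t ^ i)"
    using real_polynomial_function_imp_sum by blast
  have "(l \<longlongrightarrow> l 0) (at 0)"
    unfolding l_def by (intro tendsto_intros)
  then have "eventually (\<lambda>t. l t \<in> interior S) (at 0)"
    using z by (intro topological_tendstoD) (auto simp: l_def)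
  then obtain d where d: "d > 0" "\<And>t. t \<noteq> 0 \<Longrightarrow> dist t 0 < d \<Longrightarrow> l t \<in> interior S"
    unfolding eventually_at by blast
  have "{0<..<d} \<subseteq> {t. (\<Sum>i\<le>n. a i * t ^ i) = 0}"
  proof
    fix t assume "t \<in> {0<..<d}"
    then have "l t \<in> S" using d(2)[of t] interior_subset by (auto simp: dist_real_def)
    then show "t \<in> {t. (\<Sum>i\<le>n. a i * t ^ i) = 0}"
      using S fun_cong[OF a, of t] by simp
  qed
  then have "infinite {t. (\<Sum>i\<le>n. a i * t ^ i) = 0}"
    using d(1) infinite_Ioo finite_subset by blast
  then have "\<forall>i\<le>n. a i = 0" using polyfun_finite_roots by blast
  then have "(p \<circ> l) 1 = 0" by (simp add: a)
  then show ?thesis by (simp add: l_def)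
qed

text \<open>Between spaces of equal dimension an injective derivative is invertible, so
  \<open>f a\<close> is an interior point of the range.\<close>

lemma real_polynomial_function_vanishing_on_range:
  fixes f :: "'a::euclidean_space \<Rightarrow> 'a"
  assumes p: "real_polynomial_function p" and pf: "\<And>x. p (f x) = 0"
    and cont: "continuous_on UNIV f"
    and der: "(f has_derivative f') (at a)" and inj: "\<And>h. f' h = 0 \<Longrightarrow> h = 0"
  shows "p x = 0"
proof -
  have lin: "linear f'" using der has_derivative_linear by blast
  have "inj f'" using inj by (simp add: linear_injective_0[OF lin])
  then have "surj f'" using lin linear_inj_imp_surj by blast
  then obtain g where g: "linear g" "f' \<circ> g = id"
    using linear_surjective_right_inverse[OF lin] by blast
  have "f a \<in> interior (range f)"
    using sussmann_open_mapping[of UNIV f a f' g UNIV] cont der g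
    by (auto simp: linear_conv_bounded_linear)
  then show ?thesis
    using real_polynomial_function_vanishing_on_interior[OF p, of "range f"] pf by blast
qed

section \<open>Minors of matrices of small rank\<close>

text \<open>The columns \<open>g j\<close> span at most \<open>rank M\<close> dimensions, so some
  nonzero combination of them vanishes; its coefficients, extended by zero outside \<open>A\<close>,
  lie in the kernel of \<open>?N\<close>. Padding by the identity keeps the minor of type
  \<open>real^'v^'v\<close> without changing its determinant.\<close>

lemma det_minor_eq_0:
  fixes M :: "real^'v::finite^'v" and f g :: "'v \<Rightarrow> 'v"
  assumes "rank M < card A"
  shows "det (\<chi> i j. if i \<in> A \<and> j \<in> A then M $ f i $ g j else if i = j then 1 else 0 :: real^'v^'v) = 0"
    (is "det ?N = 0")
proof -
  define W where "W = {c::real^'v. \<forall>i. i \<notin> A \<longrightarrow> c $ i = 0}"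
  define h :: "real^'v \<Rightarrow> real^'v" where "h = (\<lambda>c. \<Sum>j\<in>A. (c $ j) *\<^sub>R axis (g j) 1)"
  define k where "k = (\<lambda>c. M *v h c)"
  have linh: "linear h"
    by (rule linearI) (simp_all add: h_def scaleR_left_distrib sum.distrib scaleR_sum_right)
  have lin: "linear k"
    using linear_compose[OF linh matrix_vector_mul_linear[of M]] by (simp add: k_def o_def)
  have W: "subspace W" by (auto simp: W_def subspace_def)
  have "(\<lambda>i. axis i 1) ` A \<subseteq> W" by (auto simp: W_def axis_def)
  moreover have "independent ((\<lambda>i. axis i 1 :: real^'v) ` A)"
    by (rule independent_mono[OF independent_Basis]) (auto simp: axis_in_Basis_iff)
  moreover have "card ((\<lambda>i. axis i 1 :: real^'v) ` A) = card A"
    by (simp add: card_image inj_on_def axis_eq_axis)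
  ultimately have dW: "card A \<le> dim W" by (metis independent_card_le_dim)
  have "\<not> inj_on k W"
  proof
    assume "inj_on k W"
    then have "dim (k ` W) = dim W"
      using dim_image_eq[OF lin] W by (simp add: span_eq_iff[THEN iffD2])
    moreover have "dim (k ` W) \<le> rank M"
      unfolding rank_dim_range by (rule dim_subset) (auto simp: k_def)
    ultimately show False using assms dW by linarith
  qed
  then obtain c where c: "c \<in> W" "k c = 0" "c \<noteq> 0"
    using linear_inj_on_iff_eq_0[OF lin W] by blast
  have Mh: "(M *v h c) $ u = (\<Sum>j\<in>A. M $ u $ g j * c $ j)" for u
    by (simp add: h_def linear_sum[OF matrix_vector_mul_linear]
        linear_cmul[OF matrix_vector_mul_linear] matrix_vector_mult_basis column_def mult.commute)
  have "(?N *v c) $ i = 0" for i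
  proof (cases "i \<in> A")
    case True
    have "(?N *v c) $ i = (\<Sum>j\<in>UNIV. if j \<in> A then M $ f i $ g j * c $ j else 0)"
      using c(1) True by (auto simp: matrix_vector_mult_def W_def intro!: sum.cong)
    also have "\<dots> = (M *v h c) $ f i" by (simp add: Mh sum.If_cases)
    finally show ?thesis using c(2) by (simp add: k_def)
  next
    case False
    then show ?thesis
      using c(1) by (auto simp: matrix_vector_mult_def W_def intro!: sum.neutral)
  qed
  then have "?N *v c = 0" by (simp add: vec_eq_iff)
  then have "\<not> invertible ?N"
    using c(3) matrix_left_invertible_ker[of ?N] by (auto simp: invertible_def)
  then show ?thesis by (simp add: invertible_det_nz)
qed

text \<open>One accessor for both summands, since the minor for m = 2 mixes diagonal and edge
  entries.\<close>

definition known_entry :: "(real^'v) \<times> (real^('v set)) \<Rightarrow> 'v \<Rightarrow> 'v \<Rightarrow> real" where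
  "known_entry x u v = (if u = v then fst x $ u else snd x $ {u, v})"

lemma known_entry_graph_proj:
  assumes "transpose M = M" "u = v \<or> {u, v} \<in> E"
  shows "known_entry (graph_proj E M) u v = M $ u $ v"
  using assms edge_entry_eq[OF assms(1)] by (auto simp: known_entry_def graph_proj_def)

lemma real_polynomial_function_known_entry:
  "real_polynomial_function (\<lambda>x. known_entry x u v)"
proof -
  have "bounded_linear (\<lambda>x::(real^'a) \<times> (real^('a set)). fst x $ i)" for i
    by (rule bounded_linear_compose[OF bounded_linear_vec_nth bounded_linear_fst])
  moreover have "bounded_linear (\<lambda>x::(real^'a) \<times> (real^('a set)). snd x $ i)" for i
    by (rule bounded_linear_compose[OF bounded_linear_vec_nth bounded_linear_snd])
  ultimately show ?thesis
    by (cases "u = v") (auto simp: known_entry_def intro: real_polynomial_function.intros(1))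
qed

text \<open>The determinant of the minor is a polynomial relation between the known entries; it is
  nontrivial because it takes the value 1 at \<open>x\<close>.\<close>

lemma not_proj_dominant_of_known_minor:
  fixes E :: "'v::finite set set" and f g :: "'v \<Rightarrow> 'v"
  assumes r: "r < card A"
    and known: "\<And>i j. i \<in> A \<Longrightarrow> j \<in> A \<Longrightarrow> f i = g j \<or> {f i, g j} \<in> E"
    and x: "x \<in> partial_matrix_space E"
      "\<And>i j. i \<in> A \<Longrightarrow> j \<in> A \<Longrightarrow> known_entry x (f i) (g j) = (if i = j then 1 else 0)"
  shows "\<not> proj_dominant E r"
proof
  assume dom: "proj_dominant E r"
  define N :: "(real^'v) \<times> (real^('v set)) \<Rightarrow> real^'v^'v" where
    "N = (\<lambda>y. \<chi> i j. if i \<in> A \<and> j \<in> A then known_entry y (f i) (g j) else if i = j then 1 else 0)"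
  have "real_polynomial_function (\<lambda>y. N y $ i $ j)" for i j
    by (cases "i \<in> A \<and> j \<in> A"; cases "i = j")
      (auto simp: N_def real_polynomial_function_known_entry intro: real_polynomial_function.intros)
  then have poly: "real_polynomial_function (\<lambda>y. det (N y))"
    unfolding det_def
    by (intro real_polynomial_function_sum real_polynomial_function.intros(4)
        real_polynomial_function_prod real_polynomial_function.intros(2)) auto
  have "det (N y) = 0" if "y \<in> graph_proj E ` sym_rank_variety r" for y
  proof -
    from that obtain M where M: "y = graph_proj E M" "transpose M = M" "rank M \<le> r"
      by (auto simp: sym_rank_variety_def)
    have "N y = (\<chi> i j. if i \<in> A \<and> j \<in> A then M $ f i $ g j else if i = j then 1 else 0)"
      by (auto simp: N_def vec_eq_iff M(1) known_entry_graph_proj[OF M(2)] known)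
    then show ?thesis using det_minor_eq_0[of M A f g] M(3) r by simp
  qed
  then have "det (N x) = 0"
    using dom poly x(1) unfolding proj_dominant_def zariski_dense_in_def by blast
  moreover have "N x = mat 1"
    by (auto simp: N_def mat_def vec_eq_iff x(2))
  ultimately show False by simp
qed

section \<open>Lower bound: ranks below m\<close>

lemma not_proj_dominant_complete_bipartite:
  fixes A B :: "'v::finite set"
  assumes m: "card A \<ge> 2" and n: "card B = card A choose 2" and disj: "A \<inter> B = {}"
    and r: "r < card A"
  shows "\<not> proj_dominant (complete_bipartite A B) r"
proof (cases "card A = 2")
  case True
  then obtain a a' where a: "A = {a, a'}" "a \<noteq> a'" by (meson card_2_iff)
  obtain b where b: "B = {b}" using n True by (auto simp: card_1_singleton_iff)
  have neq: "a \<noteq> b" "a' \<noteq> b" using disj a b by auto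
  \<comment> \<open>\<open>B\<close> has a single vertex, too few columns for a minor of rows
    \<open>A\<close> against \<open>B\<close>. Instead \<open>f\<close> indexes the principal minor
    on the edge \<open>{a, b}\<close>, and the partial matrix \<open>(1, 0)\<close> makes it the
    identity.\<close>
  define f where "f = (\<lambda>i. if i = a then a else b)"
  show ?thesis
  proof (rule not_proj_dominant_of_known_minor[OF r, of f f _ "(1, 0)"])
    fix i j assume "i \<in> A" "j \<in> A"
    then show "f i = f j \<or> {f i, f j} \<in> complete_bipartite A B"
      using a b by (auto simp: f_def complete_bipartite_def)
    show "known_entry (1, 0) (f i) (f j) = (if i = j then 1 else 0)"
      using a b neq \<open>i \<in> A\<close> \<open>j \<in> A\<close> by (auto simp: f_def known_entry_def)
  qed (simp add: partial_matrix_space_def)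
next
  case False
  then have m3: "card A \<ge> 3" using m by simp
  \<comment> \<open>Here m at least 3 matters: it gives m \<le> n, so \<open>B\<close> has room for
    m distinct columns.\<close>
  have "card A * 2 \<le> card A * (card A - 1)" using m3 by (intro mult_left_mono) auto
  then have "card A \<le> card B" unfolding n choose_two by linarith
  then obtain g where g: "inj_on g A" "g ` A \<subseteq> B"
    using card_le_inj[of A B] by auto
  \<comment> \<open>Ones exactly on the matching of each \<open>i\<close> with \<open>g i\<close>
    turn the minor into the identity.\<close>
  define x :: "(real^'v) \<times> (real^('v set))" where
    "x = (0, \<chi> e. if \<exists>i\<in>A. e = {i, g i} then 1 else 0)"
  have ne: "i \<noteq> g j" if "i \<in> A" "j \<in> A" for i j using that g disj by blast
  show ?thesis
  proof (rule not_proj_dominant_of_known_minor[OF r, of "\<lambda>i. i" g _ x])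
    fix i j assume ij: "i \<in> A" "j \<in> A"
    then show "i = g j \<or> {i, g j} \<in> complete_bipartite A B"
      using g by (auto simp: complete_bipartite_def)
    have "(\<exists>k\<in>A. {i, g j} = {k, g k}) \<longleftrightarrow> i = j"
      using ij ne g(1) by (auto simp: doubleton_eq_iff inj_on_def)
    then show "known_entry x i (g j) = (if i = j then 1 else 0)"
      using ij ne by (auto simp: known_entry_def x_def)
  next
    show "x \<in> partial_matrix_space (complete_bipartite A B)"
      using g by (auto simp: x_def partial_matrix_space_def complete_bipartite_def)
  qed
qed

section \<open>Completions of rank $m$\<close>

lemma has_derivative_vec:
  fixes f :: "'a::real_normed_vector \<Rightarrow> real^'n"
  assumes "\<And>i. ((\<lambda>x. f x $ i) has_derivative (\<lambda>h. f' h $ i)) (at a)"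
  shows "(f has_derivative f') (at a)"
  using assms by (subst has_derivative_componentwise_within) (auto simp: Basis_vec_def inner_axis)

text \<open>\<open>\<sigma>\<close> names, for each pair of elements of \<open>A\<close>, the coordinate of \<open>d\<close> used as off-diagonal
  entry.\<close>

definition pair_matrix :: "('v set \<Rightarrow> 'v) \<Rightarrow> real^'v \<Rightarrow> real^'v^'v" where
  "pair_matrix \<sigma> d = (\<chi> i j. if i = j then d $ i else d $ \<sigma> {i, j})"

text \<open>The block matrix $(I \mid Y)$, padded with zero rows outside \<open>A\<close>.\<close>

definition frame_matrix :: "'v::finite set \<Rightarrow> real^('v set) \<Rightarrow> real^'v^'v" where
  "frame_matrix A w =
     (\<chi> i v. if i \<in> A then if v \<in> A then if i = v then 1 else 0 else w $ {i, v} else 0)"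

text \<open>All parameters sit in one point \<open>x\<close>: \<open>fst x\<close> holds the
  diagonal of P on \<open>A\<close> and its off-diagonal entries at the vertices named by
  \<open>\<sigma>\<close>, while \<open>snd x\<close> holds Y on the edges.\<close>

definition gram_completion ::
  "('v set \<Rightarrow> 'v) \<Rightarrow> 'v::finite set \<Rightarrow> (real^'v) \<times> (real^('v set)) \<Rightarrow> real^'v^'v" where
  "gram_completion \<sigma> A x =
     transpose (frame_matrix A (snd x)) ** pair_matrix \<sigma> (fst x) ** frame_matrix A (snd x)"

lemma transpose_pair_matrix: "transpose (pair_matrix \<sigma> d) = pair_matrix \<sigma> d"
  by (auto simp: transpose_def pair_matrix_def vec_eq_iff insert_commute)

lemma rank_frame_matrix: "rank (frame_matrix A w) \<le> card A"
proof -
  let ?U = "frame_matrix A w"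
  have "rows ?U \<subseteq> span ((\<lambda>i. row i ?U) ` A)"
  proof
    fix y assume "y \<in> rows ?U"
    then obtain i where i: "y = row i ?U" by (auto simp: rows_def)
    show "y \<in> span ((\<lambda>i. row i ?U) ` A)"
    proof (cases "i \<in> A")
      case True
      then show ?thesis using i by (auto intro: span_base)
    next
      case False
      then have "y = 0" using i by (simp add: row_def frame_matrix_def vec_eq_iff)
      then show ?thesis by (simp add: span_zero)
    qed
  qed
  then have "dim (rows ?U) \<le> card ((\<lambda>i. row i ?U) ` A)"
    by (intro dim_le_card) auto
  also have "\<dots> \<le> card A" by (rule card_image_le) simp
  finally show ?thesis by (simp add: row_rank_def)
qed

lemma gram_completion_in_sym_rank_variety:
  "gram_completion \<sigma> A x \<in> sym_rank_variety (card A)"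
  using order_trans[OF rank_mul_le_right rank_frame_matrix]
  by (auto simp: sym_rank_variety_def gram_completion_def matrix_transpose_mul
      transpose_pair_matrix matrix_mul_assoc transpose_transpose)

lemma gram_completion_nth:
  "gram_completion \<sigma> A x $ u $ v =
     (\<Sum>i\<in>A. \<Sum>j\<in>A. frame_matrix A (snd x) $ i $ u * pair_matrix \<sigma> (fst x) $ i $ j
        * frame_matrix A (snd x) $ j $ v)" (is "_ = (\<Sum>i\<in>A. \<Sum>j\<in>A. ?t i j)")
proof -
  \<comment> \<open>The entries of \<open>pair_matrix\<close> outside \<open>A\<close> are
    meaningless; the zero rows of \<open>frame_matrix\<close> remove them.\<close>
  have z: "?t i j = 0" if "i \<notin> A \<or> j \<notin> A" for i j
    using that by (auto simp: frame_matrix_def)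
  have "gram_completion \<sigma> A x $ u $ v = (\<Sum>j\<in>UNIV. \<Sum>i\<in>UNIV. ?t i j)"
    by (simp add: gram_completion_def matrix_matrix_mult_def transpose_def sum_distrib_right)
  also have "\<dots> = (\<Sum>i\<in>UNIV. \<Sum>j\<in>UNIV. ?t i j)" by (rule sum.swap)
  also have "\<dots> = (\<Sum>i\<in>UNIV. \<Sum>j\<in>A. ?t i j)"
    using z by (intro sum.cong sum.mono_neutral_right) auto
  also have "\<dots> = (\<Sum>i\<in>A. \<Sum>j\<in>A. ?t i j)"
    using z by (intro sum.mono_neutral_right) (auto intro!: sum.neutral)
  finally show ?thesis .
qed

text \<open>The sums over \<open>e \<inter> A\<close> and \<open>e \<inter> B\<close> have one term each and merely pick out the ends of \<open>e\<close>.
  Outside the edge set the map is the identity, which makes domain and codomain agree.\<close>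

definition completion_map :: "'v::finite set \<Rightarrow> 'v set \<Rightarrow> ('v set \<Rightarrow> 'v) \<Rightarrow>
    (real^'v) \<times> (real^('v set)) \<Rightarrow> (real^'v) \<times> (real^('v set))" where
  "completion_map A B \<sigma> x =
    ((\<chi> v. if v \<in> A then fst x $ v else
        \<Sum>i\<in>A. \<Sum>j\<in>A. snd x $ {i, v} * pair_matrix \<sigma> (fst x) $ i $ j * snd x $ {j, v}),
     (\<chi> e. if e \<in> complete_bipartite A B then
        \<Sum>a\<in>e \<inter> A. \<Sum>b\<in>e \<inter> B. \<Sum>j\<in>A. pair_matrix \<sigma> (fst x) $ a $ j * snd x $ {j, b}
        else snd x $ e))"

text \<open>The product rule written out: three terms for the diagonal entries of Y^T P Y, two for
  the entries of P Y.\<close>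

definition completion_map_deriv :: "'v::finite set \<Rightarrow> 'v set \<Rightarrow> ('v set \<Rightarrow> 'v) \<Rightarrow>
    (real^'v) \<times> (real^('v set)) \<Rightarrow> (real^'v) \<times> (real^('v set)) \<Rightarrow> (real^'v) \<times> (real^('v set))" where
  "completion_map_deriv A B \<sigma> x h =
    ((\<chi> v. if v \<in> A then fst h $ v else
        \<Sum>i\<in>A. \<Sum>j\<in>A. snd h $ {i, v} * pair_matrix \<sigma> (fst x) $ i $ j * snd x $ {j, v}
          + snd x $ {i, v} * pair_matrix \<sigma> (fst h) $ i $ j * snd x $ {j, v}
          + snd x $ {i, v} * pair_matrix \<sigma> (fst x) $ i $ j * snd h $ {j, v}),
     (\<chi> e. if e \<in> complete_bipartite A B then
        \<Sum>a\<in>e \<inter> A. \<Sum>b\<in>e \<inter> B. \<Sum>j\<in>A. pair_matrix \<sigma> (fst h) $ a $ j * snd x $ {j, b}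
          + pair_matrix \<sigma> (fst x) $ a $ j * snd h $ {j, b}
        else snd h $ e))"

lemma has_derivative_completion_map:
  "(completion_map A B \<sigma> has_derivative completion_map_deriv A B \<sigma> x) (at x)"
proof -
  have f: "((\<lambda>x::(real^'a) \<times> (real^('a set)). fst x $ i) has_derivative (\<lambda>h. fst h $ i)) (at x)" for i
    by (intro bounded_linear_imp_has_derivative
        bounded_linear_compose[OF bounded_linear_vec_nth bounded_linear_fst])
  have s: "((\<lambda>x::(real^'a) \<times> (real^('a set)). snd x $ i) has_derivative (\<lambda>h. snd h $ i)) (at x)" for i
    by (intro bounded_linear_imp_has_derivative
        bounded_linear_compose[OF bounded_linear_vec_nth bounded_linear_snd])
  have p: "((\<lambda>x. pair_matrix \<sigma> (fst x) $ i $ j) has_derivative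
      (\<lambda>h. pair_matrix \<sigma> (fst h) $ i $ j)) (at x)" for i j
    using f by (cases "i = j") (simp_all add: pair_matrix_def)
  have "((\<lambda>x. if v \<in> A then fst x $ v else
        \<Sum>i\<in>A. \<Sum>j\<in>A. snd x $ {i, v} * pair_matrix \<sigma> (fst x) $ i $ j * snd x $ {j, v})
      has_derivative (\<lambda>h. fst (completion_map_deriv A B \<sigma> x h) $ v)) (at x)" for v
  proof (cases "v \<in> A")
    case True
    then show ?thesis using f by (simp add: completion_map_deriv_def)
  next
    case False
    then show ?thesis
      by (auto simp: completion_map_deriv_def algebra_simps
          intro!: derivative_eq_intros s p sum.cong)
  qed
  moreover have "((\<lambda>x. if e \<in> complete_bipartite A B then
        \<Sum>a\<in>e \<inter> A. \<Sum>b\<in>e \<inter> B. \<Sum>j\<in>A. pair_matrix \<sigma> (fst x) $ a $ j * snd x $ {j, b}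
        else snd x $ e)
      has_derivative (\<lambda>h. snd (completion_map_deriv A B \<sigma> x h) $ e)) (at x)" for e
  proof (cases "e \<in> complete_bipartite A B")
    case True
    then show ?thesis
      by (auto simp: completion_map_deriv_def algebra_simps
          intro!: derivative_eq_intros s p sum.cong)
  next
    case False
    then show ?thesis using s by (simp add: completion_map_deriv_def)
  qed
  ultimately have "(completion_map A B \<sigma> has_derivative (\<lambda>h.
      (fst (completion_map_deriv A B \<sigma> x h), snd (completion_map_deriv A B \<sigma> x h)))) (at x)"
    unfolding completion_map_def by (intro has_derivative_Pair has_derivative_vec) simp_all
  then show ?thesis by simp
qed

section \<open>Known entries of the parametrized completions\<close>

lemma Int_bipartite_edge:
  assumes "A \<inter> B = {}" "a \<in> A" "b \<in> B"
  shows "{a, b} \<inter> A = {a}" "{a, b} \<inter> B = {b}"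
  using assms by auto

text \<open>The identity block reduces row \<open>a\<close> of the completion to row
  \<open>a\<close> of P times (I | Y), which yields the diagonal of P and the entries of P Y. The
  projection discards the coordinates outside the edge set, where \<open>completion_map\<close> is
  only padding.\<close>

lemma coord_proj_completion_map:
  fixes A B :: "'v::finite set"
  assumes "A \<union> B = UNIV" "A \<inter> B = {}"
  shows "coord_proj (pm_basis (complete_bipartite A B)) (completion_map A B \<sigma> x) =
    graph_proj (complete_bipartite A B) (gram_completion \<sigma> A x)"
proof -
  let ?M = "gram_completion \<sigma> A x" and ?P = "pair_matrix \<sigma> (fst x)"
  have sym: "transpose ?M = ?M"
    using gram_completion_in_sym_rank_variety[of \<sigma> A x] by (simp add: sym_rank_variety_def)
  have row: "?M $ a $ v = (\<Sum>j\<in>A. ?P $ a $ j * frame_matrix A (snd x) $ j $ v)" if "a \<in> A" for a v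
  proof -
    have "?M $ a $ v = (\<Sum>i\<in>A. if i = a then \<Sum>j\<in>A. ?P $ a $ j * frame_matrix A (snd x) $ j $ v else 0)"
      unfolding gram_completion_nth using that by (intro sum.cong) (auto simp: frame_matrix_def)
    then show ?thesis using that by simp
  qed
  have AA: "?M $ a $ a = fst x $ a" if "a \<in> A" for a
  proof -
    have "?M $ a $ a = (\<Sum>j\<in>A. if j = a then fst x $ a else 0)"
      unfolding row[OF that] using that
      by (intro sum.cong) (auto simp: frame_matrix_def pair_matrix_def)
    then show ?thesis using that by simp
  qed
  have BB: "?M $ b $ b = (\<Sum>i\<in>A. \<Sum>j\<in>A. snd x $ {i, b} * ?P $ i $ j * snd x $ {j, b})"
    if "b \<notin> A" for b
    unfolding gram_completion_nth using that by (intro sum.cong) (auto simp: frame_matrix_def)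
  have AB: "edge_entry ?M {a, b} = (\<Sum>j\<in>A. ?P $ a $ j * snd x $ {j, b})"
    if "a \<in> A" "b \<in> B" for a b
  proof -
    have "a \<noteq> b" "b \<notin> A" using that assms by auto
    then show ?thesis
      using row[OF that(1)] by (simp add: edge_entry_eq[OF sym] frame_matrix_def)
  qed
  have edge: "snd (completion_map A B \<sigma> x) $ e = edge_entry ?M e"
    if "e \<in> complete_bipartite A B" for e
  proof -
    from that obtain a b where e: "e = {a, b}" "a \<in> A" "b \<in> B"
      by (auto simp: complete_bipartite_def)
    then show ?thesis
      using that AB by (simp add: completion_map_def Int_bipartite_edge[OF assms(2) e(2,3)])
  qed
  have "fst (completion_map A B \<sigma> x) = (\<chi> i. ?M $ i $ i)"
    by (simp add: vec_eq_iff completion_map_def AA BB)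
  then show ?thesis
    by (simp add: coord_proj_pm_basis graph_proj_def vec_eq_iff edge)
qed

text \<open>At $P = I$, $y_b = e_k + e_l$ for $\tau(b) = \{k, l\}$, the derivative of
  $y_b^T P y_b$ along a variation $H$ of $P$ that keeps $P Y$ fixed is $-y_b^T H y_b = -2 H_{kl}$.\<close>

lemma completion_map_deriv_inj:
  fixes A B :: "'v::finite set"
  assumes UN: "A \<union> B = UNIV" and disj: "A \<inter> B = {}"
    and \<tau>: "bij_betw \<tau> B {e. e \<subseteq> A \<and> card e = 2}"
    and \<sigma>: "\<And>b. b \<in> B \<Longrightarrow> \<sigma> (\<tau> b) = b"
    and x: "x = ((\<chi> v. if v \<in> A then 1 else 0),
      (\<chi> e. if \<exists>a\<in>A. \<exists>b\<in>B. e = {a, b} \<and> a \<in> \<tau> b then 1 else 0))"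
    and h: "completion_map_deriv A B \<sigma> x h = 0"
  shows "h = 0"
proof -
  let ?H = "pair_matrix \<sigma> (fst h)"
  have \<tau>_in: "\<tau> b \<subseteq> A" "card (\<tau> b) = 2" if "b \<in> B" for b
    using \<tau> that by (auto simp: bij_betw_def)
  have \<sigma>_in: "\<sigma> {i, j} \<in> B" if "i \<in> A" "j \<in> A" "i \<noteq> j" for i j
  proof -
    have "{i, j} \<in> \<tau> ` B" using \<tau> that by (auto simp: bij_betw_def)
    then show ?thesis using \<sigma> by auto
  qed
  \<comment> \<open>Off-diagonal entries are read at vertices of \<open>B\<close>, where
    \<open>fst x\<close> vanishes; hence P = I on \<open>A\<close>.\<close>
  have P: "pair_matrix \<sigma> (fst x) $ i $ j = (if i = j then 1 else 0)" if "i \<in> A" "j \<in> A" for i j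
    using that \<sigma>_in[OF that] disj by (auto simp: pair_matrix_def x)
  have Y: "snd x $ {i, b} = (if i \<in> \<tau> b then 1 else 0)" if "i \<in> A" "b \<in> B" for i b
    using that disj by (auto simp: x doubleton_eq_iff)
  have comp1: "fst (completion_map_deriv A B \<sigma> x h) $ v = 0" for v using h by simp
  have comp2: "snd (completion_map_deriv A B \<sigma> x h) $ e = 0" for e using h by simp
  have dA: "fst h $ a = 0" if "a \<in> A" for a
    using comp1[of a] that by (simp add: completion_map_deriv_def)
  have w_out: "snd h $ e = 0" if "e \<notin> complete_bipartite A B" for e
    using comp2[of e] that by (simp add: completion_map_deriv_def)
  \<comment> \<open>With W the variation of Y, the edge coordinates say H Y + W = 0.\<close>
  have w: "snd h $ {a, b} = - (\<Sum>j\<in>\<tau> b. ?H $ a $ j)" if ab: "a \<in> A" "b \<in> B" for a b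
  proof -
    have "{a, b} \<in> complete_bipartite A B" using ab by (auto simp: complete_bipartite_def)
    then have "0 = (\<Sum>j\<in>A. ?H $ a $ j * snd x $ {j, b} + pair_matrix \<sigma> (fst x) $ a $ j * snd h $ {j, b})"
      using comp2[of "{a, b}"] by (simp add: completion_map_deriv_def Int_bipartite_edge[OF disj ab])
    also have "\<dots> = (\<Sum>j\<in>A. (if j \<in> \<tau> b then ?H $ a $ j else 0) + (if j = a then snd h $ {a, b} else 0))"
      using ab by (intro sum.cong) (auto simp: P Y)
    also have "\<dots> = (\<Sum>j\<in>\<tau> b. ?H $ a $ j) + snd h $ {a, b}"
      using ab \<tau>_in(1)[OF ab(2)] by (simp add: sum.distrib sum.inter_restrict[symmetric] Int_absorb1)
    finally show ?thesis by simp
  qed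
  have dB: "fst h $ b = 0" if b: "b \<in> B" for b
  proof -
    have bA: "b \<notin> A" using b disj by auto
    obtain k l where kl: "\<tau> b = {k, l}" "k \<noteq> l" using \<tau>_in(2)[OF b] by (meson card_2_iff)
    have klA: "k \<in> A" "l \<in> A" using \<tau>_in(1)[OF b] kl by auto
    have restrict: "(\<Sum>i\<in>A. if i \<in> \<tau> b then F i else 0) = F k + F l" for F :: "'v \<Rightarrow> real"
    proof -
      have "(\<Sum>i\<in>A. if i \<in> \<tau> b then F i else 0) = sum F (\<tau> b)"
        using \<tau>_in(1)[OF b] by (simp add: sum.inter_restrict[symmetric] Int_absorb1)
      then show ?thesis using kl by simp
    qed
    have "0 = (\<Sum>i\<in>A. \<Sum>j\<in>A. snd h $ {i, b} * pair_matrix \<sigma> (fst x) $ i $ j * snd x $ {j, b}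
          + snd x $ {i, b} * ?H $ i $ j * snd x $ {j, b}
          + snd x $ {i, b} * pair_matrix \<sigma> (fst x) $ i $ j * snd h $ {j, b})"
      using comp1[of b] bA by (simp add: completion_map_deriv_def)
    \<comment> \<open>As P = I, the two terms varying Y agree, hence the factor 2.\<close>
    also have "\<dots> = (\<Sum>i\<in>A. \<Sum>j\<in>A. (if j = i then if i \<in> \<tau> b then 2 * snd h $ {i, b} else 0 else 0)
          + (if j \<in> \<tau> b then if i \<in> \<tau> b then ?H $ i $ j else 0 else 0))"
      using b by (intro sum.cong) (auto simp: P Y)
    also have "\<dots> = (\<Sum>i\<in>A. if i \<in> \<tau> b then 2 * snd h $ {i, b} else 0)
        + (\<Sum>i\<in>A. if i \<in> \<tau> b then ?H $ i $ k + ?H $ i $ l else 0)"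
    proof -
      have "(\<Sum>j\<in>A. if j \<in> \<tau> b then if i \<in> \<tau> b then ?H $ i $ j else 0 else 0) =
          (if i \<in> \<tau> b then ?H $ i $ k + ?H $ i $ l else 0)" for i
        by (subst restrict) simp
      then show ?thesis by (simp add: sum.distrib)
    qed
    also have "\<dots> = 2 * snd h $ {k, b} + 2 * snd h $ {l, b}
        + (?H $ k $ k + ?H $ k $ l + (?H $ l $ k + ?H $ l $ l))"
      unfolding restrict by simp
    \<comment> \<open>Substituting W = - H Y contributes minus twice the quadratic form of H at y_b;
      one copy cancels.\<close>
    also have "\<dots> = - (?H $ k $ k + ?H $ k $ l + (?H $ l $ k + ?H $ l $ l))"
      using kl klA b by (simp add: w)
    \<comment> \<open>The diagonal of H vanishes by \<open>dA\<close>, and both off-diagonal entries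
      equal \<open>fst h $ b\<close> because \<open>\<sigma> {k, l} = b\<close>.\<close>
    also have "\<dots> = - 2 * fst h $ b"
      using kl klA dA \<sigma>[OF b] by (simp add: pair_matrix_def insert_commute)
    finally show ?thesis by simp
  qed
  have d: "fst h = 0" using dA dB UN by (metis (no_types, lifting) UNIV_I UnE vec_eq_iff zero_index)
  then have "?H = 0" by (simp add: pair_matrix_def vec_eq_iff)
  then have "snd h $ e = 0" for e
    using w w_out[of e] by (cases "e \<in> complete_bipartite A B") (auto simp: complete_bipartite_def)
  then have "snd h = 0" by (simp add: vec_eq_iff)
  with d show ?thesis by (simp add: prod_eq_iff)
qed

section \<open>Dominance in rank m and the resulting value\<close>

lemma proj_dominant_complete_bipartite:
  fixes A B :: "'v::finite set"
  assumes UN: "A \<union> B = UNIV" and disj: "A \<inter> B = {}" and n: "card B = card A choose 2"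
  shows "proj_dominant (complete_bipartite A B) (card A)"
proof -
  let ?E = "complete_bipartite A B"
  \<comment> \<open>The value of n enters here. The bijection \<open>\<tau>\<close> selects the
    columns y_b of the base point, and its inverse \<open>\<sigma>\<close> stores the off-diagonal
    entries of P on \<open>B\<close>.\<close>
  have "card B = card {e. e \<subseteq> A \<and> card e = 2}" using n by (simp add: n_subsets)
  then obtain \<tau> where \<tau>: "bij_betw \<tau> B {e. e \<subseteq> A \<and> card e = 2}"
    using finite_same_card_bij[of B "{e. e \<subseteq> A \<and> card e = 2}"] by auto
  define \<sigma> where "\<sigma> = inv_into B \<tau>"
  have \<sigma>: "\<sigma> (\<tau> b) = b" if "b \<in> B" for b
    using \<tau> that by (simp add: \<sigma>_def bij_betw_def)
  have "p z = 0" if p: "real_polynomial_function p"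
    and vanish: "\<forall>y\<in>graph_proj ?E ` sym_rank_variety (card A). p y = 0"
    and z: "z \<in> partial_matrix_space ?E" for p z
  proof -
    \<comment> \<open>A proper coordinate subspace has empty interior, so \<open>p\<close> is first
      composed with the projection; the composite is a polynomial on the whole space and vanishes on
      the range of \<open>completion_map\<close>.\<close>
    have "polynomial_function (coord_proj (pm_basis ?E))"
      unfolding coord_proj_def
      by (intro polynomial_function_bounded_linear
          linear_conv_bounded_linear[THEN iffD1] linearI)
        (simp_all add: inner_add_left scaleR_left_distrib sum.distrib scaleR_sum_right)
    then have "real_polynomial_function (p \<circ> coord_proj (pm_basis ?E))"
      using p by (rule real_polynomial_function_compose)
    moreover have "(p \<circ> coord_proj (pm_basis ?E)) (completion_map A B \<sigma> y) = 0" for y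
      using vanish gram_completion_in_sym_rank_variety[of \<sigma> A y]
      by (simp add: coord_proj_completion_map[OF UN disj])
    moreover have "continuous_on UNIV (completion_map A B \<sigma>)"
      using has_derivative_continuous[OF has_derivative_completion_map]
      by (auto simp: continuous_on_eq_continuous_at)
    ultimately have "(p \<circ> coord_proj (pm_basis ?E)) z = 0"
      using completion_map_deriv_inj[OF UN disj \<tau> \<sigma> refl]
      by (rule real_polynomial_function_vanishing_on_range[OF _ _ _ has_derivative_completion_map])
    then show ?thesis using coord_proj_id[OF z] by simp
  qed
  then show ?thesis
    using graph_proj_in by (auto simp: proj_dominant_def zariski_dense_in_def)
qed

theorem theorem2p5:
  fixes A B :: "'v::finite set" and m n :: nat
  assumes "m \<ge> 2" and "n = m choose 2"
    and "A \<union> B = UNIV" and "A \<inter> B = {}" and "card A = m" and "card B = n"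
  shows "gcr (complete_bipartite A B) = m"
  unfolding gcr_def
proof (rule Least_equality)
  show "proj_dominant (complete_bipartite A B) m"
    using proj_dominant_complete_bipartite[of A B] assms by simp
next
  fix r assume "proj_dominant (complete_bipartite A B) r"
  then show "m \<le> r"
    using not_proj_dominant_complete_bipartite[of A B r] assms by force
qed

end
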